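(* Let $A \in \mathbb{R}^{m\times n}$ have rank $r$, let $\Omega \subseteq \{1,\dots,m\}\times\{1,\dots,n\}$, and let $g$, $S_\tau$ and the operator $T:\mathbb{R}^{m\times n}\to\mathbb{R}^{m\times n}$ be as defined in the context. Let $X^0 \in \mathbb{R}^{m\times n}$ and let $\{X^k\}$ be the sequence generated by $X^k = T(X^{k-1})$, $k = 1,2,\dots$. If the sequence $\{\sigma_{r+1}(X^k - \nabla g(X^k))\}_{k\ge 0}$ is summable, i.e. $\sum_{k=0}^\infty \sigma_{r+1}(X^k - \nabla g(X^k)) < \infty$, then $\{X^k\}$ is quasi-Fejér convergent to the set $$\mathcal{X}^* = \{X \in \mathbb{R}^{m\times n} \mid \operatorname{rank}(X)\le r,\ P_\Omega(X) = P_\Omega(A)\}.$$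
   Context: For a set of indices $\Omega \subseteq \{1,\dots,m\}\times\{1,\dots,n\}$, the projection $P_\Omega$ on $\mathbb{R}^{m\times n}$ is defined by $[P_\Omega(X)]_{ij} = X_{ij}$ if $(i,j)\in\Omega$ and $[P_\Omega(X)]_{ij}=0$ otherwise. For a matrix $M\in\mathbb{R}^{m\times n}$, $\sigma_1(M)\ge\sigma_2(M)\ge\dots\ge\sigma_{\min\{m,n\}}(M)\ge 0$ denote its singular values, with the convention $\sigma_i(M)=0$ for $i>\min\{m,n\}$. Soft-thresholding operator: for $\tau\ge 0$ and a matrix $M$ of rank $q$ with compact SVD $M = U\Sigma V^\top$, $\Sigma=\operatorname{diag}[\sigma_1,\dots,\sigma_q]$, set $S_\tau(M) = U\Sigma_\tau V^\top$ with $\Sigma_\tau = \operatorname{diag}[(\sigma_1-\tau)_+,\dots,(\sigma_q-\tau)_+]$, where $t_+=\max(0,t)$ (and $S_\tau(0)=0$). Given the matrix $A$ of rank $r$, define $g(X) = \frac12\|P_\Omega(X-A)\|_F^2$, so that $\nabla g(X) = P_\Omega(X-A)$, and $$T(X) = S_{\sigma_{r+1}(X-\nabla g(X))}\bigl(X-\nabla g(X)\bigr).$$ Quasi-Fejér convergence: a sequence $\{X^k\}_{k\ge0}$ in $\mathbb{R}^{m\times n}$ is quasi-Fejér convergent to $C\subset\mathbb{R}^{m\times n}$ if, for each $X^\star\in C$, there exists a non-negative summable sequence $\{\varepsilon_k\}$ such that $\|X^k - X^\star\|\le\|X^{k-1}-X^\star\|+\varepsilon_k$ for $k=1,2,\dots$.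 Here $\|\cdot\|=\|\cdot\|_F$ is the Frobenius norm. *)

theory Defs
  imports "HOL-Analysis.Analysis"
begin

text \<open>
  An \<open>m \<times> n\<close> matrix is an element of \<^typ>\<open>real^'n^'m\<close>, with entries \<open>M $ i $ j\<close>
  for \<open>i :: 'm\<close> and \<open>j :: 'n\<close>. The library norm and inner product of this type are
  the Frobenius ones.
\<close>

lemma norm_eq_frobenius:
  fixes M :: "real^'n^'m"
  shows "norm M = sqrt (\<Sum>i\<in>UNIV. \<Sum>j\<in>UNIV. (M $ i $ j)\<^sup>2)"
  by (simp add: norm_vec_def L2_set_def sum_nonneg)

definition proj_on :: "('m \<times> 'n) set \<Rightarrow> real^'n^'m \<Rightarrow> real^'n^'m" where
  "proj_on \<Omega> X = (\<chi> i j. if (i, j) \<in> \<Omega> then X $ i $ j else 0)"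

text \<open>
  The matrix \<open>U diag[s 1, \<dots>, s q] V\<^sup>T\<close>, where \<open>u k\<close> and \<open>v k\<close> are the \<open>k\<close>-th columns of
  \<open>U\<close> and \<open>V\<close>. As \<open>q\<close> is a number and not a type, \<open>U\<close> and \<open>V\<close> are families of columns
  with indices \<open>1, \<dots>, q\<close>.
\<close>
definition svd_product ::
    "nat \<Rightarrow> (nat \<Rightarrow> real^'m) \<Rightarrow> (nat \<Rightarrow> real) \<Rightarrow> (nat \<Rightarrow> real^'n) \<Rightarrow> real^'n^'m" where
  "svd_product q u s v = (\<chi> i j. \<Sum>k\<in>{1..q}. u k $ i * s k * v k $ j)"

definition orthonormal_columns :: "nat \<Rightarrow> (nat \<Rightarrow> 'a::real_inner) \<Rightarrow> bool" where
  "orthonormal_columns q u \<longleftrightarrow>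
     (\<forall>i\<in>{1..q}. \<forall>j\<in>{1..q}. u i \<bullet> u j = (if i = j then 1 else 0))"

definition compact_svd ::
    "real^'n^'m \<Rightarrow> (nat \<Rightarrow> real^'m) \<Rightarrow> (nat \<Rightarrow> real) \<Rightarrow> (nat \<Rightarrow> real^'n) \<Rightarrow> bool" where
  "compact_svd M u s v \<longleftrightarrow>
     orthonormal_columns (rank M) u \<and> orthonormal_columns (rank M) v \<and>
     (\<forall>i\<in>{1..rank M}. 0 < s i) \<and>
     (\<forall>i\<in>{1..rank M}. \<forall>j\<in>{1..rank M}. i \<le> j \<longrightarrow> s j \<le> s i) \<and>
     M = svd_product (rank M) u s v"

text \<open>
  The singular values are numbered from \<open>1\<close>. Those beyond the rank are \<open>0\<close>; this includes
  the convention for indices beyond the number of rows or columns. The numbers \<open>s i\<close>, and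
  the matrix in the definition of soft thresholding below, do not depend on the compact
  SVD chosen.
\<close>
definition singular_value :: "nat \<Rightarrow> real^'n^'m \<Rightarrow> real" where
  "singular_value i M =
     (THE t. \<exists>u s v. compact_svd M u s v \<and> t = (if i \<in> {1..rank M} then s i else 0))"

definition soft_threshold :: "real \<Rightarrow> real^'n^'m \<Rightarrow> real^'n^'m" where
  "soft_threshold \<tau> M =
     (THE N. \<exists>u s v. compact_svd M u s v \<and>
        N = svd_product (rank M) u (\<lambda>k. max 0 (s k - \<tau>)) v)"

definition gradient :: "('a::real_inner \<Rightarrow> real) \<Rightarrow> 'a \<Rightarrow> 'a" where
  "gradient f x = (THE d. GDERIV f x :> d)"

definition g_fun :: "real^'n^'m \<Rightarrow> ('m \<times> 'n) set \<Rightarrow> real^'n^'m \<Rightarrow> real" where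
  "g_fun A \<Omega> X = 1 / 2 * (norm (proj_on \<Omega> (X - A)))\<^sup>2"

text \<open>The step \<open>X - \<nabla>g(X)\<close>, which occurs both in \<open>T\<close> and in its threshold.\<close>
definition grad_step :: "real^'n^'m \<Rightarrow> ('m \<times> 'n) set \<Rightarrow> real^'n^'m \<Rightarrow> real^'n^'m" where
  "grad_step A \<Omega> X = X - gradient (g_fun A \<Omega>) X"

definition T_op :: "real^'n^'m \<Rightarrow> ('m \<times> 'n) set \<Rightarrow> real^'n^'m \<Rightarrow> real^'n^'m" where
  "T_op A \<Omega> X =
     soft_threshold (singular_value (rank A + 1) (grad_step A \<Omega> X)) (grad_step A \<Omega> X)"

definition quasi_fejer_convergent :: "(nat \<Rightarrow> 'a::real_normed_vector) \<Rightarrow> 'a set \<Rightarrow> bool" where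
  "quasi_fejer_convergent X C \<longleftrightarrow>
     (\<forall>x\<in>C. \<exists>\<epsilon> :: nat \<Rightarrow> real. (\<forall>k. 0 \<le> \<epsilon> k) \<and> summable \<epsilon> \<and>
        (\<forall>k\<ge>1. norm (X k - x) \<le> norm (X (k - 1) - x) + \<epsilon> k))"

lemma gradient_eqI:
  assumes "GDERIV f x :> d"
  shows "gradient f x = d"
  unfolding gradient_def
proof (rule the_equality)
  fix e assume "GDERIV f x :> e"
  then have "(\<lambda>h. h \<bullet> e) = (\<lambda>h. h \<bullet> d)"
    using assms has_derivative_unique unfolding gderiv_def by blast
  then have "(e - d) \<bullet> e = (e - d) \<bullet> d" by metis
  then have "(e - d) \<bullet> (e - d) = 0" by (simp add: inner_diff_right)
  then show "e = d" by simp
qed (fact assms)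

lemma gradient_g_fun:
  fixes A X :: "real^'n^'m"
  shows "gradient (g_fun A \<Omega>) X = proj_on \<Omega> (X - A)"
proof (rule gradient_eqI)
  have lin: "bounded_linear (proj_on \<Omega> :: real^'n^'m \<Rightarrow> real^'n^'m)"
    by (auto intro!: linearI simp: proj_on_def vec_eq_iff simp flip: linear_conv_bounded_linear)
  have self: "proj_on \<Omega> h \<bullet> proj_on \<Omega> Y = h \<bullet> proj_on \<Omega> Y" for h Y :: "real^'n^'m"
    unfolding inner_vec_def proj_on_def by (intro sum.cong) auto
  have "((\<lambda>Z. proj_on \<Omega> (Z - A)) has_derivative proj_on \<Omega>) (at X)"
    by (rule bounded_linear.has_derivative[OF lin]) (auto intro!: derivative_eq_intros)
  from has_derivative_inner[OF this this]
  have "((\<lambda>Z. 1 / 2 * (proj_on \<Omega> (Z - A) \<bullet> proj_on \<Omega> (Z - A))) has_derivative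
          (\<lambda>h. 1 / 2 * (proj_on \<Omega> (X - A) \<bullet> proj_on \<Omega> h + proj_on \<Omega> h \<bullet> proj_on \<Omega> (X - A)))) (at X)"
    by (rule has_derivative_mult_right)
  moreover have "(\<lambda>h. 1 / 2 * (proj_on \<Omega> (X - A) \<bullet> proj_on \<Omega> h + proj_on \<Omega> h \<bullet> proj_on \<Omega> (X - A)))
      = (\<lambda>h. h \<bullet> proj_on \<Omega> (X - A))"
    using self[of _ "X - A"] inner_commute[of "proj_on \<Omega> (X - A)"] by auto
  ultimately show "GDERIV (g_fun A \<Omega>) X :> proj_on \<Omega> (X - A)"
    unfolding gderiv_def g_fun_def[abs_def] power2_norm_eq_inner by simp
qed

end

theory Submission
  imports Defs
begin


text \<open>
  Fix \<open>Y\<close> in the target set and let \<open>Z\<close> be the gradient step at \<open>X\<close>, with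
  \<open>\<tau> = \<sigma>\<^bsub>r+1\<^esub>(Z)\<close>. Since \<open>A\<close> and \<open>Y\<close> agree on \<open>\<Omega>\<close>, the step replaces the entries of
  \<open>X\<close> in \<open>\<Omega>\<close> by those of \<open>Y\<close>, so \<open>\<parallel>Z - Y\<parallel> \<le> \<parallel>X - Y\<parallel>\<close> (\<open>norm_grad_step_le\<close>).
  Soft thresholding at a fixed level \<open>\<tau> \<ge> 0\<close> is nonexpansive
  (\<open>soft_threshold_nonexpansive\<close>), and it moves \<open>Y\<close>, which has at most \<open>r\<close> nonzero singular
  values, by at most \<open>\<surd>r \<tau>\<close> (\<open>soft_threshold_dist\<close>). By the triangle inequality
  \<open>\<parallel>T X - Y\<parallel> \<le> \<parallel>X - Y\<parallel> + \<surd>r \<tau>\<close>, so the errors are \<open>\<surd>r\<close> times the thresholds, and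
  these are summable.

  The inequality behind nonexpansiveness concerns matrices given with a decomposition, and it
  also shows that the definite descriptions for soft thresholding and for the singular values
  denote. For a compact SVD of \<open>M\<close> let \<open>N\<close> be the shrunk matrix and \<open>D = M - N\<close>. Then
  \<open>D\<close> has the singular values \<open>min s\<^sub>k \<tau>\<close>, so its spectral norm is at most \<open>\<tau>\<close>, and
  \<open>N \<bullet> D = \<tau> \<Sum> max 0 (s\<^sub>k - \<tau>)\<close> is the largest value that \<open>N \<bullet> D'\<close> attains for
  spectral norm of \<open>D'\<close> at most \<open>\<tau>\<close>. For two such pairs this gives
  \<open>(N - N') \<bullet> (D - D') \<ge> 0\<close>, hence \<open>\<parallel>N - N'\<parallel> \<le> \<parallel>M - M'\<parallel>\<close>. The case \<open>M = M'\<close>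
  says that \<open>N\<close> depends on \<open>M\<close> and \<open>\<tau>\<close> alone. As \<open>rank N\<close> counts the \<open>s\<^sub>k\<close> above \<open>\<tau>\<close>,
  these counts, and so the ordered list of the \<open>s\<^sub>k\<close>, depend on \<open>M\<close> alone too. A compact SVD
  exists because a maximising pair of unit vectors for \<open>x \<bullet> M y\<close> splits off a rank-one
  summand, and the rank drops.
\<close>

section \<open>Sums of rank-one matrices over orthonormal families\<close>

lemma svd_product_mult_vec:
  "svd_product q u s v *v x = (\<Sum>k\<in>{1..q}. (s k * (v k \<bullet> x)) *\<^sub>R u k)"
proof -
  have "(\<Sum>j\<in>UNIV. (\<Sum>k\<in>{1..q}. u k $ i * s k * v k $ j) * x $ j)
      = (\<Sum>k\<in>{1..q}. s k * (\<Sum>j\<in>UNIV. v k $ j * x $ j) * u k $ i)" for i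
    unfolding sum_distrib_right sum_distrib_left
    by (subst sum.swap) (simp add: ac_simps)
  then show ?thesis
    by (simp add: vec_eq_iff svd_product_def matrix_vector_mult_def inner_vec_def)
qed

lemma inner_svd_product_mult_vec:
  "x \<bullet> (svd_product q u s v *v y) = (\<Sum>k\<in>{1..q}. s k * (u k \<bullet> x) * (v k \<bullet> y))"
  unfolding svd_product_mult_vec inner_sum_right
  by (intro sum.cong) (simp_all add: inner_commute)

lemma inner_svd_product:
  "svd_product q u s v \<bullet> W = (\<Sum>k\<in>{1..q}. s k * (u k \<bullet> (W *v v k)))"
proof -
  have "svd_product q u s v \<bullet> W
      = (\<Sum>i\<in>UNIV. \<Sum>j\<in>UNIV. \<Sum>k\<in>{1..q}. s k * (u k $ i * (W $ i $ j * v k $ j)))"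
    by (simp add: inner_vec_def svd_product_def sum_distrib_left sum_distrib_right ac_simps)
  also have "\<dots> = (\<Sum>i\<in>UNIV. \<Sum>k\<in>{1..q}. \<Sum>j\<in>UNIV. s k * (u k $ i * (W $ i $ j * v k $ j)))"
    by (intro sum.cong refl sum.swap)
  also have "\<dots> = (\<Sum>k\<in>{1..q}. \<Sum>i\<in>UNIV. \<Sum>j\<in>UNIV. s k * (u k $ i * (W $ i $ j * v k $ j)))"
    by (rule sum.swap)
  also have "\<dots> = (\<Sum>k\<in>{1..q}. s k * (u k \<bullet> (W *v v k)))"
    by (simp add: inner_vec_def matrix_vector_mult_def sum_distrib_left)
  finally show ?thesis .
qed

lemma svd_product_diff:
  "svd_product q u s v - svd_product q u t v = svd_product q u (\<lambda>k. s k - t k) v"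
  by (simp add: svd_product_def vec_eq_iff sum_subtractf[symmetric] algebra_simps)

lemma orthonormal_columns_inner:
  assumes "orthonormal_columns q u" "i \<in> {1..q}" "j \<in> {1..q}"
  shows "u i \<bullet> u j = (if i = j then 1 else 0)"
  using assms unfolding orthonormal_columns_def by blast

lemma orthonormal_columns_norm:
  assumes "orthonormal_columns q u" "k \<in> {1..q}"
  shows "norm (u k) = 1"
  using orthonormal_columns_inner[OF assms(1,2,2)] by (simp add: norm_eq_sqrt_inner)

lemma svd_product_column:
  assumes "orthonormal_columns q v" "k \<in> {1..q}"
  shows "svd_product q u s v *v v k = s k *\<^sub>R u k"
proof -
  have "(s j * (v j \<bullet> v k)) *\<^sub>R u j = (if j = k then s k *\<^sub>R u k else 0)" if "j \<in> {1..q}" for j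
    using orthonormal_columns_inner[OF assms(1) that assms(2)] by simp
  then show ?thesis
    using assms(2) by (simp add: svd_product_mult_vec)
qed

lemma bessel_inequality:
  assumes "orthonormal_columns q u"
  shows "(\<Sum>k\<in>{1..q}. (u k \<bullet> x)\<^sup>2) \<le> (norm x)\<^sup>2"
proof -
  define p where "p = (\<Sum>k\<in>{1..q}. (u k \<bullet> x) *\<^sub>R u k)"
  have up: "u k \<bullet> p = u k \<bullet> x" if k: "k \<in> {1..q}" for k
  proof -
    have "(u j \<bullet> x) * (u k \<bullet> u j) = (if j = k then u k \<bullet> x else 0)" if "j \<in> {1..q}" for j
      using orthonormal_columns_inner[OF assms k that] by auto
    then show ?thesis
      using k by (simp add: p_def inner_sum_right)
  qed
  have xp: "x \<bullet> p = (\<Sum>k\<in>{1..q}. (u k \<bullet> x)\<^sup>2)"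
    unfolding p_def inner_sum_right by (simp add: power2_eq_square inner_commute)
  have "p \<bullet> p = (\<Sum>k\<in>{1..q}. (u k \<bullet> x) * (u k \<bullet> p))"
    by (subst (1) p_def) (simp add: inner_sum_left)
  also have "\<dots> = x \<bullet> p"
    unfolding xp by (intro sum.cong refl) (simp only: up power2_eq_square)
  finally have "0 \<le> x \<bullet> x - x \<bullet> p"
    using inner_ge_zero[of "x - p"] by (simp add: inner_diff inner_commute)
  then show ?thesis
    by (simp add: xp power2_norm_eq_inner)
qed

text \<open>
  The spectral norm of a matrix with all singular values in \<open>[0, \<tau>]\<close> is at most \<open>\<tau>\<close>. In each
  summand \<open>a b \<le> (a\<^sup>2 + b\<^sup>2) / 2\<close>, and Bessel's inequality bounds the sums of squares by \<open>1\<close>.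
\<close>
lemma svd_product_bilinear_bound:
  assumes u: "orthonormal_columns q u" and v: "orthonormal_columns q v"
    and c: "\<And>k. k \<in> {1..q} \<Longrightarrow> 0 \<le> c k \<and> c k \<le> \<tau>" and "0 \<le> \<tau>"
    and "norm x = 1" "norm y = 1"
  shows "x \<bullet> (svd_product q u c v *v y) \<le> \<tau>"
proof -
  have "c k * (u k \<bullet> x) * (v k \<bullet> y) \<le> \<tau> * (((u k \<bullet> x)\<^sup>2 + (v k \<bullet> y)\<^sup>2) / 2)"
    if "k \<in> {1..q}" for k
  proof -
    have "(u k \<bullet> x) * (v k \<bullet> y) \<le> ((u k \<bullet> x)\<^sup>2 + (v k \<bullet> y)\<^sup>2) / 2"
      using sum_squares_bound[of "u k \<bullet> x" "v k \<bullet> y"] by simp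
    then have "c k * ((u k \<bullet> x) * (v k \<bullet> y)) \<le> c k * (((u k \<bullet> x)\<^sup>2 + (v k \<bullet> y)\<^sup>2) / 2)"
      using c[OF that] by (intro mult_left_mono) auto
    also have "\<dots> \<le> \<tau> * (((u k \<bullet> x)\<^sup>2 + (v k \<bullet> y)\<^sup>2) / 2)"
      using c[OF that] by (intro mult_right_mono) auto
    finally show ?thesis by (simp add: mult.assoc)
  qed
  then have "x \<bullet> (svd_product q u c v *v y)
      \<le> (\<Sum>k\<in>{1..q}. \<tau> * (((u k \<bullet> x)\<^sup>2 + (v k \<bullet> y)\<^sup>2) / 2))"
    unfolding inner_svd_product_mult_vec by (rule sum_mono)
  also have "\<dots> = \<tau> * (((\<Sum>k\<in>{1..q}. (u k \<bullet> x)\<^sup>2) + (\<Sum>k\<in>{1..q}. (v k \<bullet> y)\<^sup>2)) / 2)"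
    by (simp add: sum_distrib_left[symmetric] sum_divide_distrib[symmetric] sum.distrib)
  also have "\<dots> \<le> \<tau> * ((1 + 1) / 2)"
    using bessel_inequality[OF u, of x] bessel_inequality[OF v, of y] assms(4-6)
    by (intro mult_left_mono divide_right_mono add_mono) auto
  finally show ?thesis by simp
qed

lemma norm_svd_product:
  assumes u: "orthonormal_columns q u" and v: "orthonormal_columns q v"
  shows "(norm (svd_product q u c v))\<^sup>2 = (\<Sum>k\<in>{1..q}. (c k)\<^sup>2)"
  unfolding power2_norm_eq_inner inner_svd_product
proof (intro sum.cong refl)
  fix k assume k: "k \<in> {1..q}"
  show "c k * (u k \<bullet> (svd_product q u c v *v v k)) = (c k)\<^sup>2"
    using orthonormal_columns_inner[OF u k k]
    by (simp add: svd_product_column[OF v k] power2_eq_square)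
qed

text \<open>The columns \<open>u k\<close> with \<open>c k \<noteq> 0\<close> are an orthonormal basis of the range.\<close>
lemma rank_svd_product:
  fixes u :: "nat \<Rightarrow> real^'m" and v :: "nat \<Rightarrow> real^'n"
  assumes u: "orthonormal_columns q u" and v: "orthonormal_columns q v"
  shows "rank (svd_product q u c v) = card {k \<in> {1..q}. c k \<noteq> 0}"
proof -
  let ?K = "{k \<in> {1..q}. c k \<noteq> 0}" and ?M = "svd_product q u c v"
  have inj: "inj_on u ?K"
    using orthonormal_columns_inner[OF u] by (intro inj_onI) (smt (verit) mem_Collect_eq)
  have indep: "independent (u ` ?K)"
  proof (rule pairwise_orthogonal_independent)
    show "pairwise orthogonal (u ` ?K)"
      unfolding pairwise_def orthogonal_def using orthonormal_columns_inner[OF u] by fastforce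
    show "0 \<notin> u ` ?K"
      using orthonormal_columns_norm[OF u] by force
  qed
  have "range ((*v) ?M) \<subseteq> span (u ` ?K)"
  proof (rule image_subsetI)
    fix x
    have "(c k * (v k \<bullet> x)) *\<^sub>R u k \<in> span (u ` ?K)" if "k \<in> {1..q}" for k
    proof (cases "c k = 0")
      case True
      then show ?thesis by (simp add: span_zero)
    next
      case False
      then have "u k \<in> u ` ?K" using that by blast
      then show ?thesis by (intro span_scale span_base)
    qed
    then show "?M *v x \<in> span (u ` ?K)"
      unfolding svd_product_mult_vec by (rule span_sum)
  qed
  moreover have "u ` ?K \<subseteq> range ((*v) ?M)"
  proof clarify
    fix k assume k: "k \<in> {1..q}" "c k \<noteq> 0"
    have "?M *v (v k /\<^sub>R c k) = u k"
      using k by (simp add: matrix_vector_mult_scaleR svd_product_column[OF v k(1)])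
    then show "u k \<in> range ((*v) ?M)" by (metis rangeI)
  qed
  ultimately have "dim (range ((*v) ?M)) = card (u ` ?K)"
    using indep dim_unique by blast
  then show ?thesis
    using card_image[OF inj] by (simp add: rank_dim_range)
qed

section \<open>Existence of a compact singular value decomposition\<close>

text \<open>
  The bilinear form \<open>x \<bullet> M y\<close> attains its maximum \<open>\<sigma>\<close> over pairs of unit vectors at some
  \<open>(a, b)\<close>. With either argument fixed there, the form is a linear functional that is maximal
  on the sphere at the other one, so the vector representing it is a multiple of that one:
  \<open>M b = \<sigma> a\<close> and \<open>M\<^sup>T a = \<sigma> b\<close>.
\<close>
lemma top_singular_triple:
  fixes M :: "real^'n^'m"
  assumes "M \<noteq> 0"
  obtains \<sigma> a b where "0 < \<sigma>" "norm a = 1" "norm b = 1" "M *v b = \<sigma> *\<^sub>R a"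
    "\<And>y. a \<bullet> (M *v y) = \<sigma> * (b \<bullet> y)"
    "\<And>x y. norm x = 1 \<Longrightarrow> norm y = 1 \<Longrightarrow> x \<bullet> (M *v y) \<le> \<sigma>"
proof -
  let ?S = "sphere 0 1 \<times> sphere 0 1 :: ((real^'m) \<times> (real^'n)) set"
  have "compact ?S" by (intro compact_Times compact_sphere)
  moreover have "?S \<noteq> {}" by simp
  moreover have "continuous_on ?S (\<lambda>p. fst p \<bullet> (M *v snd p))"
    by (intro continuous_intros bounded_linear.continuous_on[OF matrix_vector_mul_bounded_linear])
  ultimately have "\<exists>p\<in>?S. \<forall>p'\<in>?S. fst p' \<bullet> (M *v snd p') \<le> fst p \<bullet> (M *v snd p)"
    by (rule continuous_attains_sup)
  then obtain p where p: "p \<in> ?S"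
    "\<forall>p'\<in>?S. fst p' \<bullet> (M *v snd p') \<le> fst p \<bullet> (M *v snd p)"
    by (rule bexE)
  define a b \<sigma> where "a = fst p" and "b = snd p" and "\<sigma> = a \<bullet> (M *v b)"
  have na: "norm a = 1" and nb: "norm b = 1"
    using p(1) by (auto simp: a_def b_def)
  have max: "x \<bullet> (M *v y) \<le> \<sigma>" if "norm x = 1" "norm y = 1" for x y
    using bspec[OF p(2), of "(x, y)"] that by (simp add: a_def b_def \<sigma>_def)
  \<comment> \<open>The equality case of the Cauchy-Schwarz inequality, used for both arguments.\<close>
  have eq: "w = \<sigma> *\<^sub>R e"
    if "e \<bullet> w = \<sigma>" "norm e = 1" "\<And>x. norm x = 1 \<Longrightarrow> x \<bullet> w \<le> \<sigma>" for w e :: "'a::real_inner"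
  proof (cases "w = 0")
    case True then show ?thesis using that by simp
  next
    case False
    have "norm w = (w /\<^sub>R norm w) \<bullet> w"
      using False by (simp add: dot_square_norm power2_eq_square field_simps)
    also have "\<dots> \<le> \<sigma>"
      using False by (intro that(3)) simp
    finally have "norm w \<le> \<sigma>" .
    then have "(norm w)\<^sup>2 \<le> \<sigma>\<^sup>2" by (simp add: power_mono)
    moreover have "(norm (w - \<sigma> *\<^sub>R e))\<^sup>2 = (norm w)\<^sup>2 - 2 * \<sigma> * (e \<bullet> w) + \<sigma>\<^sup>2 * (norm e)\<^sup>2"
      unfolding power2_norm_eq_inner
      by (simp add: inner_diff inner_commute power2_eq_square algebra_simps)
    ultimately have "(norm (w - \<sigma> *\<^sub>R e))\<^sup>2 \<le> 0"
      using that by (simp add: power2_eq_square)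
    then show ?thesis by simp
  qed
  have Mb: "M *v b = \<sigma> *\<^sub>R a"
    by (rule eq) (use na nb max in \<open>auto simp: \<sigma>_def\<close>)
  have "a v* M = \<sigma> *\<^sub>R b"
  proof (rule eq)
    show "b \<bullet> (a v* M) = \<sigma>"
      by (simp add: inner_commute[of b] dot_lmul_matrix \<sigma>_def)
    show "x \<bullet> (a v* M) \<le> \<sigma>" if "norm x = 1" for x
      using max[OF na that] by (simp add: inner_commute[of x] dot_lmul_matrix)
  qed (fact nb)
  then have aM: "a \<bullet> (M *v y) = \<sigma> * (b \<bullet> y)" for y
    using dot_lmul_matrix[of a M y] by simp
  have "0 < \<sigma>"
  proof (rule ccontr)
    assume "\<not> 0 < \<sigma>"
    have "M *v y = 0" for y
    proof (rule ccontr)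
      assume n: "M *v y \<noteq> 0"
      then have y: "y \<noteq> 0" by auto
      have "((M *v y) /\<^sub>R norm (M *v y)) \<bullet> (M *v (y /\<^sub>R norm y)) \<le> \<sigma>"
        using n y by (intro max) auto
      moreover have "0 < ((M *v y) /\<^sub>R norm (M *v y)) \<bullet> (M *v (y /\<^sub>R norm y))"
        using n y by (simp add: matrix_vector_mult_scaleR)
      ultimately show False using \<open>\<not> 0 < \<sigma>\<close> by simp
    qed
    then show False using assms by (simp add: matrix_eq)
  qed
  with Mb aM na nb max show ?thesis using that by blast
qed

text \<open>
  Subtracting the top rank-one summand \<open>\<sigma> a b\<^sup>T\<close> leaves a matrix whose range lies in that of
  \<open>M\<close> but is orthogonal to \<open>a\<close>, so induction on the rank applies. The remaining singular
  vectors are orthogonal to \<open>a\<close> and \<open>b\<close>, so the remaining singular values are also values of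
  the bilinear form of \<open>M\<close> and are at most \<open>\<sigma>\<close>: the list comes out sorted.
\<close>
lemma svd_exists:
  fixes M :: "real^'n^'m"
  shows "\<exists>q u s v. orthonormal_columns q u \<and> orthonormal_columns q v \<and>
    (\<forall>i\<in>{1..q}. 0 < s i) \<and> (\<forall>i\<in>{1..q}. \<forall>j\<in>{1..q}. i \<le> j \<longrightarrow> s j \<le> s i) \<and>
    M = svd_product q u s v"
proof (induction "rank M" arbitrary: M rule: less_induct)
  case less
  show ?case
  proof (cases "M = 0")
    case True
    then have "M = svd_product 0 (\<lambda>_. 0) (\<lambda>_. 0) (\<lambda>_. 0)"
      by (simp add: svd_product_def vec_eq_iff)
    then show ?thesis
      by (intro exI[of _ 0] exI[of _ "\<lambda>_. 0"]) (simp add: orthonormal_columns_def)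
  next
    case False
    then obtain \<sigma> a b where \<sigma>: "0 < \<sigma>" and na: "norm a = 1" and nb: "norm b = 1"
      and Mb: "M *v b = \<sigma> *\<^sub>R a" and aM: "\<And>y. a \<bullet> (M *v y) = \<sigma> * (b \<bullet> y)"
      and max: "\<And>x y. norm x = 1 \<Longrightarrow> norm y = 1 \<Longrightarrow> x \<bullet> (M *v y) \<le> \<sigma>"
      by (rule top_singular_triple) blast
    define N where "N = M - svd_product 1 (\<lambda>_. a) (\<lambda>_. \<sigma>) (\<lambda>_. b)"
    have N: "N *v y = M *v y - (\<sigma> * (b \<bullet> y)) *\<^sub>R a" for y
      by (simp add: N_def matrix_vector_mult_diff_rdistrib svd_product_mult_vec)
    have aa: "a \<bullet> a = 1" and bb: "b \<bullet> b = 1"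
      using na nb by (simp_all add: norm_eq_1)
    have Nb: "N *v b = 0" and aN: "a \<bullet> (N *v y) = 0" for y
      by (simp_all add: N Mb aM bb aa inner_diff_right)
    have lin: "subspace (range ((*v) C))" for C :: "real^'n^'m"
      by (intro linear_subspace_image matrix_vector_mul_linear subspace_UNIV)
    have "N *v y = M *v (y - (b \<bullet> y) *\<^sub>R b)" for y
      by (simp add: N Mb matrix_vector_mult_diff_distrib matrix_vector_mult_scaleR)
    then have "range ((*v) N) \<subseteq> range ((*v) M)" by blast
    moreover have "\<sigma> *\<^sub>R a \<in> range ((*v) M)" using Mb by (metis rangeI)
    moreover have "\<sigma> *\<^sub>R a \<notin> range ((*v) N)"
    proof
      assume "\<sigma> *\<^sub>R a \<in> range ((*v) N)"
      then obtain y where "\<sigma> *\<^sub>R a = N *v y" by blast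
      then have "a \<bullet> (\<sigma> *\<^sub>R a) = 0" by (simp add: aN)
      then show False using \<sigma> aa by simp
    qed
    ultimately have "range ((*v) N) \<subset> range ((*v) M)" by blast
    then have "dim (range ((*v) N)) < dim (range ((*v) M))"
      by (intro dim_psubset) (simp add: span_eq_iff[THEN iffD2, OF lin])
    then have "rank N < rank M" by (simp add: rank_dim_range)
    from less[OF this] obtain q u s v where u: "orthonormal_columns q u"
      and v: "orthonormal_columns q v" and pos: "\<And>i. i \<in> {1..q} \<Longrightarrow> 0 < s i"
      and sorted: "\<And>i j. i \<in> {1..q} \<Longrightarrow> j \<in> {1..q} \<Longrightarrow> i \<le> j \<Longrightarrow> s j \<le> s i"
      and Nsvd: "N = svd_product q u s v"
      by blast
    have Nv: "N *v v k = s k *\<^sub>R u k" if "k \<in> {1..q}" for k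
      unfolding Nsvd by (rule svd_product_column[OF v that])
    have au: "a \<bullet> u k = 0" if "k \<in> {1..q}" for k
      using aN[of "v k"] pos[OF that] by (simp add: Nv[OF that])
    \<comment> \<open>Test \<open>N b = 0\<close> against \<open>u k\<close>; only the term \<open>s k * (v k \<bullet> b)\<close> survives.\<close>
    have bv: "b \<bullet> v k = 0" if k: "k \<in> {1..q}" for k
    proof -
      have "s j * (u j \<bullet> u k) * (v j \<bullet> b) = (if j = k then s k * (v k \<bullet> b) else 0)"
        if "j \<in> {1..q}" for j
        using orthonormal_columns_inner[OF u that k] by simp
      then have "u k \<bullet> (N *v b) = s k * (v k \<bullet> b)"
        using k by (simp add: Nsvd inner_svd_product_mult_vec)
      then show ?thesis using Nb pos[OF k] by (simp add: inner_commute)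
    qed
    have le: "s k \<le> \<sigma>" if k: "k \<in> {1..q}" for k
    proof -
      have "u k \<bullet> (M *v v k) = u k \<bullet> (N *v v k)"
        by (simp add: N bv[OF k])
      also have "\<dots> = s k"
        using orthonormal_columns_inner[OF u k k] by (simp add: Nv[OF k])
      finally show ?thesis
        using max orthonormal_columns_norm[OF u k] orthonormal_columns_norm[OF v k] by metis
    qed
    \<comment> \<open>The new triple takes index \<open>1\<close> and the inductive ones move up by one.\<close>
    define u' where "u' k = (if k = 1 then a else u (k - 1))" for k
    define v' where "v' k = (if k = 1 then b else v (k - 1))" for k
    define s' where "s' k = (if k = 1 then \<sigma> else s (k - 1))" for k
    have shift: "k = 1 \<or> k - 1 \<in> {1..q}" if "k \<in> {1..Suc q}" for k
      using that by auto
    have "orthonormal_columns (Suc q) u'"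
      unfolding orthonormal_columns_def
    proof (intro ballI)
      fix i j assume "i \<in> {1..Suc q}" "j \<in> {1..Suc q}"
      then show "u' i \<bullet> u' j = (if i = j then 1 else 0)"
        using shift[of i] shift[of j] orthonormal_columns_inner[OF u, of "i - 1" "j - 1"]
          au[of "i - 1"] au[of "j - 1"] aa
        by (auto simp: u'_def inner_commute)
    qed
    moreover have "orthonormal_columns (Suc q) v'"
      unfolding orthonormal_columns_def
    proof (intro ballI)
      fix i j assume "i \<in> {1..Suc q}" "j \<in> {1..Suc q}"
      then show "v' i \<bullet> v' j = (if i = j then 1 else 0)"
        using shift[of i] shift[of j] orthonormal_columns_inner[OF v, of "i - 1" "j - 1"]
          bv[of "i - 1"] bv[of "j - 1"] bb
        by (auto simp: v'_def inner_commute)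
    qed
    moreover have "\<forall>i\<in>{1..Suc q}. 0 < s' i"
      using shift pos \<sigma> unfolding s'_def by metis
    moreover have "\<forall>i\<in>{1..Suc q}. \<forall>j\<in>{1..Suc q}. i \<le> j \<longrightarrow> s' j \<le> s' i"
    proof (intro ballI impI)
      fix i j assume "i \<in> {1..Suc q}" "j \<in> {1..Suc q}" "i \<le> j"
      then show "s' j \<le> s' i"
        using shift[of i] shift[of j] sorted[of "i - 1" "j - 1"] le[of "j - 1"]
        by (auto simp: s'_def)
    qed
    moreover have "M = svd_product (Suc q) u' s' v'"
    proof -
      have split: "(\<Sum>k\<in>{1..Suc q}. f k) = f 1 + (\<Sum>k\<in>{1..q}. f (Suc k))" for f :: "nat \<Rightarrow> real"
        using sum.atLeast_Suc_atMost[of 1 "Suc q" f] sum.shift_bounds_cl_Suc_ivl[of f 1 q]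
        by (simp del: sum.cl_ivl_Suc)
      have tail: "(\<Sum>k\<in>{1..q}. u' (Suc k) $ i * s' (Suc k) * v' (Suc k) $ j)
          = (\<Sum>k\<in>{1..q}. u k $ i * s k * v k $ j)" for i j
        by (intro sum.cong) (auto simp: u'_def v'_def s'_def)
      have "svd_product (Suc q) u' s' v' $ i $ j
          = (svd_product 1 (\<lambda>_. a) (\<lambda>_. \<sigma>) (\<lambda>_. b) + N) $ i $ j" for i j
        unfolding Nsvd svd_product_def vec_lambda_beta vector_add_component split tail
        by (simp add: u'_def v'_def s'_def)
      then have "svd_product (Suc q) u' s' v' = svd_product 1 (\<lambda>_. a) (\<lambda>_. \<sigma>) (\<lambda>_. b) + N"
        by (simp add: vec_eq_iff)
      then show ?thesis by (simp add: N_def)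
    qed
    ultimately show ?thesis by blast
  qed
qed

lemma compact_svd_exists: "\<exists>u s v. compact_svd M u s v"
proof -
  obtain q u s v where *: "orthonormal_columns q u" "orthonormal_columns q v"
    "\<forall>i\<in>{1..q}. 0 < s i" "\<forall>i\<in>{1..q}. \<forall>j\<in>{1..q}. i \<le> j \<longrightarrow> s j \<le> s i"
    "M = svd_product q u s v"
    using svd_exists by metis
  have "{k \<in> {1..q}. s k \<noteq> 0} = {1..q}" using *(3) by force
  then have "rank M = q" using rank_svd_product[OF *(1,2), of s] *(5) by simp
  then show ?thesis using * unfolding compact_svd_def by blast
qed

section \<open>Soft thresholding and singular values\<close>

text \<open>
  The shrinkage \<open>M \<mapsto> N\<close> is the proximal map of \<open>\<tau>\<close> times the nuclear norm, and the argument is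
  the usual one for such maps. With \<open>D = M - N\<close> the cross term in
  \<open>\<parallel>M - M'\<parallel>\<^sup>2 = \<parallel>N - N'\<parallel>\<^sup>2 + 2 (N - N') \<bullet> (D - D') + \<parallel>D - D'\<parallel>\<^sup>2\<close> is nonnegative by
  duality of the nuclear and the spectral norm. The statement is about arbitrary compact SVDs,
  so that it also yields independence of the choice.
\<close>
lemma compact_svd_shrink_nonexpansive:
  assumes M: "compact_svd M u s v" and M': "compact_svd M' u' s' v'" and "0 \<le> \<tau>"
  shows "norm (svd_product (rank M) u (\<lambda>k. max 0 (s k - \<tau>)) v
      - svd_product (rank M') u' (\<lambda>k. max 0 (s' k - \<tau>)) v') \<le> norm (M - M')"
proof -
  \<comment> \<open>\<open>N \<bullet> D' \<le> N \<bullet> D\<close>: where \<open>N\<close> has weight \<open>t k - \<tau> > 0\<close>, the form of \<open>D\<close> takes its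
    largest possible value \<open>\<tau>\<close> at \<open>(a k, b k)\<close>.\<close>
  have pairing: "svd_product (rank L) a (\<lambda>k. max 0 (t k - \<tau>)) b
        \<bullet> svd_product (rank K) c (\<lambda>k. min (p k) \<tau>) d
      \<le> svd_product (rank L) a (\<lambda>k. max 0 (t k - \<tau>)) b
        \<bullet> svd_product (rank L) a (\<lambda>k. min (t k) \<tau>) b"
    if L: "compact_svd L a t b" and K: "compact_svd K c p d"
    for L K :: "real^'a^'b" and a b c d t p
    unfolding inner_svd_product
  proof (rule sum_mono)
    fix k assume k: "k \<in> {1..rank L}"
    have a: "orthonormal_columns (rank L) a" and b: "orthonormal_columns (rank L) b"
      using L by (auto simp: compact_svd_def)
    have "a k \<bullet> (svd_product (rank K) c (\<lambda>k. min (p k) \<tau>) d *v b k) \<le> \<tau>"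
      using K \<open>0 \<le> \<tau>\<close> orthonormal_columns_norm[OF a k] orthonormal_columns_norm[OF b k]
      by (intro svd_product_bilinear_bound) (auto simp: compact_svd_def less_imp_le)
    then have "max 0 (t k - \<tau>) * (a k \<bullet> (svd_product (rank K) c (\<lambda>k. min (p k) \<tau>) d *v b k))
        \<le> max 0 (t k - \<tau>) * \<tau>"
      by (rule mult_left_mono) simp
    also have "\<dots> = max 0 (t k - \<tau>) * min (t k) \<tau>"
      by (simp add: max_def min_def)
    also have "\<dots> = max 0 (t k - \<tau>)
        * (a k \<bullet> (svd_product (rank L) a (\<lambda>k. min (t k) \<tau>) b *v b k))"
      using orthonormal_columns_inner[OF a k k] by (simp add: svd_product_column[OF b k])
    finally show "max 0 (t k - \<tau>) * (a k \<bullet> (svd_product (rank K) c (\<lambda>k. min (p k) \<tau>) d *v b k))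
        \<le> max 0 (t k - \<tau>) * (a k \<bullet> (svd_product (rank L) a (\<lambda>k. min (t k) \<tau>) b *v b k))" .
  qed
  have split: "L - svd_product (rank L) a (\<lambda>k. max 0 (t k - \<tau>)) b
      = svd_product (rank L) a (\<lambda>k. min (t k) \<tau>) b"
    if L: "compact_svd L a t b" for L :: "real^'a^'b" and a b t
  proof -
    have "(\<lambda>k. t k - max 0 (t k - \<tau>)) = (\<lambda>k. min (t k) \<tau>)" by (auto simp: max_def min_def)
    moreover have "svd_product (rank L) a t b = L" using L by (simp add: compact_svd_def)
    ultimately show ?thesis
      using svd_product_diff[of "rank L" a t b "\<lambda>k. max 0 (t k - \<tau>)"] by (simp only:)
  qed
  define N N' where "N = svd_product (rank M) u (\<lambda>k. max 0 (s k - \<tau>)) v"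
    and "N' = svd_product (rank M') u' (\<lambda>k. max 0 (s' k - \<tau>)) v'"
  have "N \<bullet> (M' - N') \<le> N \<bullet> (M - N)" "N' \<bullet> (M - N) \<le> N' \<bullet> (M' - N')"
    unfolding N_def N'_def split[OF M] split[OF M']
    by (rule pairing[OF M M'], rule pairing[OF M' M])
  then have "0 \<le> (N - N') \<bullet> ((M - N) - (M' - N'))"
    by (simp add: inner_diff_left inner_diff_right)
  moreover have "(M - M') \<bullet> (M - M') = (N - N') \<bullet> (N - N')
      + 2 * ((N - N') \<bullet> ((M - N) - (M' - N')))
      + ((M - N) - (M' - N')) \<bullet> ((M - N) - (M' - N'))"
    by (simp add: inner_diff_left inner_diff_right inner_commute algebra_simps)
  ultimately have "(N - N') \<bullet> (N - N') \<le> (M - M') \<bullet> (M - M')"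
    using inner_ge_zero[of "(M - N) - (M' - N')"] by linarith
  then show ?thesis
    unfolding N_def N'_def by (simp add: norm_le)
qed

lemma soft_threshold_eq:
  assumes "compact_svd M u s v" "0 \<le> \<tau>"
  shows "soft_threshold \<tau> M = svd_product (rank M) u (\<lambda>k. max 0 (s k - \<tau>)) v"
  unfolding soft_threshold_def
proof (rule the_equality)
  fix N assume "\<exists>u s v. compact_svd M u s v \<and>
      N = svd_product (rank M) u (\<lambda>k. max 0 (s k - \<tau>)) v"
  then show "N = svd_product (rank M) u (\<lambda>k. max 0 (s k - \<tau>)) v"
    using compact_svd_shrink_nonexpansive[OF _ assms, of M] by fastforce
qed (use assms in blast)

lemma soft_threshold_nonexpansive:
  assumes "0 \<le> \<tau>"
  shows "norm (soft_threshold \<tau> M - soft_threshold \<tau> M') \<le> norm (M - M')"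
proof -
  obtain u s v u' s' v' where "compact_svd M u s v" "compact_svd M' u' s' v'"
    using compact_svd_exists by metis
  then show ?thesis
    using compact_svd_shrink_nonexpansive assms soft_threshold_eq by metis
qed

lemma rank_soft_threshold:
  assumes "compact_svd M u s v" "0 \<le> \<tau>"
  shows "rank (soft_threshold \<tau> M) = card {k \<in> {1..rank M}. \<tau> < s k}"
proof -
  have "{k \<in> {1..rank M}. max 0 (s k - \<tau>) \<noteq> 0} = {k \<in> {1..rank M}. \<tau> < s k}" by auto
  moreover have "orthonormal_columns (rank M) u" "orthonormal_columns (rank M) v"
    using assms(1) by (simp_all add: compact_svd_def)
  ultimately show ?thesis
    unfolding soft_threshold_eq[OF assms] by (simp only: rank_svd_product)
qed

text \<open>
  Threshold at \<open>\<tau> = s i\<close> and compute the rank of the result in both decompositions: at most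
  \<open>i - 1\<close> of the values \<open>s k\<close> exceed \<open>\<tau>\<close>, but if \<open>s' i > s i\<close> at least \<open>i\<close> of the \<open>s' k\<close> do.
\<close>
lemma compact_svd_values_le:
  assumes M: "compact_svd M u s v" and M': "compact_svd M u' s' v'" and i: "i \<in> {1..rank M}"
  shows "s' i \<le> s i"
proof (rule ccontr)
  assume "\<not> s' i \<le> s i"
  then have less: "s i < s' i" by simp
  have "0 \<le> s i" using M i by (auto simp: compact_svd_def intro: less_imp_le)
  then have eq: "card {k \<in> {1..rank M}. s i < s k} = card {k \<in> {1..rank M}. s i < s' k}"
    using rank_soft_threshold[OF M] rank_soft_threshold[OF M'] by simp
  have "{k \<in> {1..rank M}. s i < s k} \<subseteq> {1..<i}"
  proof
    fix k assume "k \<in> {k \<in> {1..rank M}. s i < s k}"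
    then have k: "k \<in> {1..rank M}" "s i < s k" by auto
    have "\<not> i \<le> k" using M i k unfolding compact_svd_def by (meson not_le)
    with k show "k \<in> {1..<i}" by simp
  qed
  then have few: "card {k \<in> {1..rank M}. s i < s k} \<le> i - 1"
    using card_mono[of "{1..<i}"] by fastforce
  have "{1..i} \<subseteq> {k \<in> {1..rank M}. s i < s' k}"
  proof
    fix k assume k: "k \<in> {1..i}"
    then have k': "k \<in> {1..rank M}" "k \<le> i" using i by auto
    then have "s' i \<le> s' k" using M' i unfolding compact_svd_def by blast
    with k' less show "k \<in> {k \<in> {1..rank M}. s i < s' k}" by auto
  qed
  then have "i \<le> card {k \<in> {1..rank M}. s i < s' k}"
    using card_mono[of "{k \<in> {1..rank M}. s i < s' k}" "{1..i}"] by fastforce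
  moreover have "1 \<le> i" using i by simp
  ultimately show False using few eq by linarith
qed

lemma singular_value_eq:
  assumes "compact_svd M u s v"
  shows "singular_value i M = (if i \<in> {1..rank M} then s i else 0)"
  unfolding singular_value_def
proof (rule the_equality)
  fix t assume "\<exists>u s v. compact_svd M u s v \<and> t = (if i \<in> {1..rank M} then s i else 0)"
  then obtain u' s' v' where M': "compact_svd M u' s' v'"
    and t: "t = (if i \<in> {1..rank M} then s' i else 0)" by blast
  show "t = (if i \<in> {1..rank M} then s i else 0)"
    using compact_svd_values_le[OF assms M'] compact_svd_values_le[OF M' assms] t
    by (auto intro: antisym)
qed (use assms in blast)

lemma singular_value_nonneg: "0 \<le> singular_value i M"
proof -
  obtain u s v where M: "compact_svd M u s v" using compact_svd_exists by metis
  then show ?thesis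
    unfolding singular_value_eq[OF M] by (auto simp: compact_svd_def intro: less_imp_le)
qed

text \<open>Thresholding lowers each of the \<open>rank M\<close> positive singular values by at most \<open>\<tau>\<close>.\<close>
lemma soft_threshold_dist:
  assumes "0 \<le> \<tau>"
  shows "norm (soft_threshold \<tau> M - M) \<le> sqrt (rank M) * \<tau>"
proof -
  obtain u s v where M: "compact_svd M u s v" using compact_svd_exists by metis
  then have u: "orthonormal_columns (rank M) u" and v: "orthonormal_columns (rank M) v"
    and pos: "\<And>k. k \<in> {1..rank M} \<Longrightarrow> 0 < s k" and Meq: "M = svd_product (rank M) u s v"
    by (auto simp: compact_svd_def)
  have "soft_threshold \<tau> M - M = svd_product (rank M) u (\<lambda>k. max 0 (s k - \<tau>) - s k) v"
    unfolding soft_threshold_eq[OF M assms] by (subst (2) Meq) (rule svd_product_diff)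
  then have "(norm (soft_threshold \<tau> M - M))\<^sup>2
      = (\<Sum>k\<in>{1..rank M}. (max 0 (s k - \<tau>) - s k)\<^sup>2)"
    by (simp add: norm_svd_product[OF u v])
  also have "\<dots> \<le> (\<Sum>k\<in>{1..rank M}. \<tau>\<^sup>2)"
  proof (rule sum_mono)
    fix k assume "k \<in> {1..rank M}"
    then have "\<bar>max 0 (s k - \<tau>) - s k\<bar> \<le> \<bar>\<tau>\<bar>" using pos[of k] assms by auto
    then show "(max 0 (s k - \<tau>) - s k)\<^sup>2 \<le> \<tau>\<^sup>2" by (simp only: abs_le_square_iff)
  qed
  also have "\<dots> = (sqrt (rank M) * \<tau>)\<^sup>2" by (simp add: power_mult_distrib)
  finally show ?thesis by (rule power2_le_imp_le) (use assms in simp)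
qed

section \<open>Quasi-Fejer convergence\<close>

text \<open>
  On \<open>\<Omega>\<close> the entries of \<open>grad_step A \<Omega> X\<close> are those of \<open>A\<close>, hence of \<open>Y\<close>; elsewhere they are
  those of \<open>X\<close>.
\<close>
lemma norm_grad_step_le:
  assumes "proj_on \<Omega> Y = proj_on \<Omega> A"
  shows "norm (grad_step A \<Omega> X - Y) \<le> norm (X - Y)"
proof -
  have "Y $ i $ j = A $ i $ j" if "(i, j) \<in> \<Omega>" for i j
    using arg_cong[OF assms, of "\<lambda>M. M $ i $ j"] that by (simp add: proj_on_def)
  then have "norm ((grad_step A \<Omega> X - Y) $ i $ j) \<le> norm ((X - Y) $ i $ j)" for i j
    unfolding grad_step_def gradient_g_fun by (simp add: proj_on_def)
  then show ?thesis
    by (intro norm_le_componentwise_cart)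
qed

theorem theorem2p5:
  fixes A :: "real^'n^'m" and \<Omega> :: "('m \<times> 'n) set"
    and r :: nat and X :: "nat \<Rightarrow> real^'n^'m"
  assumes "rank A = r"
    and "\<And>k. k \<ge> 1 \<Longrightarrow> X k = T_op A \<Omega> (X (k - 1))"
    and "summable (\<lambda>k. singular_value (r + 1) (X k - gradient (g_fun A \<Omega>) (X k)))"
  shows "quasi_fejer_convergent X
           {Y :: real^'n^'m. rank Y \<le> r \<and> proj_on \<Omega> Y = proj_on \<Omega> A}"
  unfolding quasi_fejer_convergent_def
proof (rule ballI)
  fix Y assume "Y \<in> {Y :: real^'n^'m. rank Y \<le> r \<and> proj_on \<Omega> Y = proj_on \<Omega> A}"
  then have rank: "rank Y \<le> r" and proj: "proj_on \<Omega> Y = proj_on \<Omega> A" by auto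
  define \<tau> where "\<tau> k = singular_value (r + 1) (grad_step A \<Omega> (X k))" for k
  have \<tau>: "0 \<le> \<tau> k" for k
    unfolding \<tau>_def by (rule singular_value_nonneg)
  have "summable \<tau>"
    using assms(3) by (simp add: \<tau>_def[abs_def] grad_step_def)
  then have "summable (\<lambda>k. sqrt r * \<tau> (k - 1))"
    using summable_Suc_iff[of "\<lambda>k. sqrt r * \<tau> (k - 1)"] by (simp add: summable_mult)
  moreover have "norm (X k - Y) \<le> norm (X (k - 1) - Y) + sqrt r * \<tau> (k - 1)" if "k \<ge> 1" for k
  proof -
    define t Z where "t = \<tau> (k - 1)" and "Z = grad_step A \<Omega> (X (k - 1))"
    have t: "0 \<le> t" by (simp add: t_def \<tau>)
    have "X k = soft_threshold t Z"
      using assms(1,2) that by (simp add: T_op_def t_def \<tau>_def Z_def)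
    then have "norm (X k - Y)
        \<le> norm (soft_threshold t Z - soft_threshold t Y) + norm (soft_threshold t Y - Y)"
      using norm_triangle_ineq[of "soft_threshold t Z - soft_threshold t Y" "soft_threshold t Y - Y"]
      by simp
    also have "\<dots> \<le> norm (Z - Y) + sqrt (rank Y) * t"
      by (intro add_mono soft_threshold_nonexpansive soft_threshold_dist t)
    also have "\<dots> \<le> norm (X (k - 1) - Y) + sqrt r * t"
      unfolding Z_def using rank t
      by (intro add_mono mult_right_mono norm_grad_step_le proj) auto
    finally show ?thesis by (simp add: t_def)
  qed
  ultimately show "\<exists>\<epsilon> :: nat \<Rightarrow> real. (\<forall>k. 0 \<le> \<epsilon> k) \<and> summable \<epsilon> \<and>
        (\<forall>k\<ge>1. norm (X k - Y) \<le> norm (X (k - 1) - Y) + \<epsilon> k)"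
    using \<tau> by (intro exI[of _ "\<lambda>k. sqrt r * \<tau> (k - 1)"]) auto
qed

end
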